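(* The reverse-norm space $\mathbb{H}_*$ is closed under the action of $D_*$ if and only if there is a constant $C>0$ such that for every $\alpha\in L^2(d\mu_\lambda)$ one has $\mathcal{S}(\alpha)\in L^2(d\mu_\lambda)$ and $$\|\mathcal{S}(\alpha)\|_{L^2(d\mu_\lambda)}\le C\,\|\alpha\|_{L^2(d\mu_\lambda)}^2 .$$
   Context: $\mathbb{H}$ is a real Hilbert space, $\Gamma$ is a bounded linear operator on $\mathbb{H}$ that is self-adjoint, one-to-one, but not (boundedly) invertible, and $D:\mathbb{H}\times\mathbb{H}\to\mathbb{H}$ is a bounded bilinear map. By spectral decomposition of $\Gamma$, each $u\in\mathbb{H}$ is identified with its spectral coordinates $(u_\lambda)_{\lambda\in\Lambda}\in L^2(\Lambda,d\mu_\lambda)$, with $\mu$ the spectral measure and $\|u\|_{\mathbb{H}}^2=\int_\Lambda|u_\lambda|^2\,d\mu_\lambda$; in these coordinates $\Gamma$ is multiplication by a real bounded function $(\gamma_\lambda)_{\lambda\in\Lambda}$. $D_\lambda(u,v)$ denotes the $\lambda$-coordinate of $D(u,v)$. The reverse norm of a function $u$ on $\mathbb{R}_+=[0,\infty)$ with values in $\mathbb{H}$ is $$\|u\|_{\mathbb{H}_*}=\Big(\int_\Lambda\big(\sup_{x\ge0}|u_\lambda(x)|\big)^2\,d\mu_\lambda\Big)^{1/2},$$ and $\mathbb{H}_*$ is the space of functions on $\mathbb{R}_+$ with finite $\|\cdot\|_{\mathbb{H}_*}$ norm. $D_*$ is the pointwise extension of $D$ to functions: $D_*(u,v)(x)=D(u(x),v(x))$.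 The space $\mathbb{H}_*$ is said to be closed under the action of $D_*$ if $D_*(v,v)\in\mathbb{H}_*$ for every $v\in\mathbb{H}_*$ and there is a constant $C$ with $\|D_*(v,v)\|_{\mathbb{H}_*}\le C\|v\|_{\mathbb{H}_*}^2$ for all $v\in\mathbb{H}_*$. For $\alpha\in L^2(d\mu_\lambda)$ set $\mathcal{E}_\alpha=\{v\in\mathbb{H}:|v_\lambda|\le|\alpha_\lambda|\text{ for any }\lambda\in\Lambda\}$, and define the function $\mathcal{S}(\alpha)=(\mathcal{S}_\lambda(\alpha))_{\lambda\in\Lambda}$ by $\mathcal{S}_\lambda(\alpha)=\sup_{v\in\mathcal{E}_\alpha}|D_\lambda(v,v)|$. *)

theory Defs
  imports "HOL-Analysis.Analysis"
begin

section \<open>The space \<open>L\<^sup>2\<close> of a measure\<close>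

definition esqrt :: "ennreal \<Rightarrow> ennreal" where
  "esqrt x = (if x = \<infinity> then \<infinity> else ennreal (sqrt (enn2real x)))"

definition L2_norm :: "'l measure \<Rightarrow> ('l \<Rightarrow> ennreal) \<Rightarrow> ennreal" where
  "L2_norm M f = esqrt (\<integral>\<^sup>+ l. (f l)\<^sup>2 \<partial>M)"

abbreviation mag :: "('l \<Rightarrow> real) \<Rightarrow> 'l \<Rightarrow> ennreal" where
  "mag f \<equiv> (\<lambda>l. ennreal \<bar>f l\<bar>)"

text \<open>\<open>L2\<close> consists of real functions, \<open>L2_ext\<close> of functions with values in \<open>[0,\<infinity>]\<close>.
  Elements are functions; statements about them are made almost everywhere.\<close>

definition L2 :: "'l measure \<Rightarrow> ('l \<Rightarrow> real) set" where
  "L2 M = {f \<in> borel_measurable M. L2_norm M (mag f) < \<infinity>}"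

definition L2_ext :: "'l measure \<Rightarrow> ('l \<Rightarrow> ennreal) set" where
  "L2_ext M = {f \<in> borel_measurable M. L2_norm M f < \<infinity>}"


section \<open>Suprema of families of functions defined almost everywhere\<close>

text \<open>The coordinates of a vector are determined only up to a null set, so a supremum over an
  uncountable family of vectors cannot be taken at each point separately: it would depend on the
  choice of representatives. It is the supremum in the lattice of measurable functions modulo
  null sets, that is, the least measurable function dominating almost everywhere each member of
  the family. For countable families this is the pointwise supremum
  (\<open>is_ae_Sup_countable\<close> below).

  On a measure that is not \<open>\<sigma>\<close>-finite, a family may lack such a supremum. It always exists if
  the family is dominated by some function in \<open>L2_ext M\<close>; so when it does not exist, no upper
  bound has finite \<open>L2_norm\<close>, and the value \<open>\<infinity>\<close> is assigned.\<close>

definition is_ae_Sup :: "'l measure \<Rightarrow> ('l \<Rightarrow> ennreal) set \<Rightarrow> ('l \<Rightarrow> ennreal) \<Rightarrow> bool" where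
  "is_ae_Sup M F g \<longleftrightarrow>
     g \<in> borel_measurable M \<and>
     (\<forall>f\<in>F. AE l in M. f l \<le> g l) \<and>
     (\<forall>h\<in>borel_measurable M. (\<forall>f\<in>F. AE l in M. f l \<le> h l) \<longrightarrow> (AE l in M. g l \<le> h l))"

definition ae_Sup :: "'l measure \<Rightarrow> ('l \<Rightarrow> ennreal) set \<Rightarrow> 'l \<Rightarrow> ennreal" where
  "ae_Sup M F = (if \<exists>g. is_ae_Sup M F g then SOME g. is_ae_Sup M F g else (\<lambda>_. \<infinity>))"

lemma is_ae_Sup_unique:
  assumes "is_ae_Sup M F g" and "is_ae_Sup M F h"
  shows "AE l in M. g l = h l"
proof -
  have "AE l in M. g l \<le> h l" "AE l in M. h l \<le> g l"
    using assms unfolding is_ae_Sup_def by blast+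
  then show ?thesis by eventually_elim (rule antisym)
qed

lemma is_ae_Sup_countable:
  assumes "countable F" and "F \<subseteq> borel_measurable M"
  shows "is_ae_Sup M F (\<lambda>l. SUP f\<in>F. f l)"
  unfolding is_ae_Sup_def
proof (intro conjI ballI impI)
  show "(\<lambda>l. SUP f\<in>F. f l) \<in> borel_measurable M"
    using assms by (intro borel_measurable_SUP) auto
next
  fix f assume "f \<in> F"
  then show "AE l in M. f l \<le> (SUP f\<in>F. f l)" by (auto intro: SUP_upper)
next
  fix h assume "\<forall>f\<in>F. AE l in M. f l \<le> h l"
  then have "AE l in M. \<forall>f\<in>F. f l \<le> h l"
    using assms(1) by (simp add: AE_ball_countable)
  then show "AE l in M. (SUP f\<in>F. f l) \<le> h l"
    by eventually_elim (auto intro: SUP_least)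
qed


section \<open>Spectral coordinates\<close>

definition boundedly_invertible :: "('h::real_normed_vector \<Rightarrow> 'h) \<Rightarrow> bool" where
  "boundedly_invertible T \<longleftrightarrow> (\<exists>S. bounded_linear S \<and> S \<circ> T = id \<and> T \<circ> S = id)"

text \<open>\<open>U u l\<close> is the coordinate \<open>u\<^sub>l\<close>, for some choice of representatives. Modulo null sets, \<open>U\<close> is
  an isometric isomorphism onto \<open>L\<^sup>2(\<Lambda>,\<mu>)\<close>, where \<open>\<Lambda> = space M\<close>, which turns \<open>\<Gamma>\<close> into
  multiplication by \<open>\<gamma>\<close>.\<close>

definition spectral_coordinates ::
  "('h::real_inner \<Rightarrow> 'h) \<Rightarrow> 'l measure \<Rightarrow> ('l \<Rightarrow> real) \<Rightarrow> ('h \<Rightarrow> 'l \<Rightarrow> real) \<Rightarrow> bool" where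
  "spectral_coordinates \<Gamma> M \<gamma> U \<longleftrightarrow>
     \<gamma> \<in> borel_measurable M \<and> bounded (\<gamma> ` space M) \<and>
     (\<forall>u. U u \<in> L2 M) \<and>
     (\<forall>u v. AE l in M. U (u + v) l = U u l + U v l) \<and>
     (\<forall>c u. AE l in M. U (c *\<^sub>R u) l = c * U u l) \<and>
     (\<forall>u. L2_norm M (mag (U u)) = ennreal (norm u)) \<and>
     (\<forall>f\<in>L2 M. \<exists>u. AE l in M. U u l = f l) \<and>
     (\<forall>u. AE l in M. U (\<Gamma> u) l = \<gamma> l * U u l)"


section \<open>The reverse norm and the pointwise action of a bilinear map\<close>

text \<open>Functions on \<open>[0,\<infinity>)\<close> are represented by functions on the whole real line, of which only
  the values on \<open>{0..}\<close> are used.\<close>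

definition reverse_norm ::
  "'l measure \<Rightarrow> ('h \<Rightarrow> 'l \<Rightarrow> real) \<Rightarrow> (real \<Rightarrow> 'h) \<Rightarrow> ennreal" where
  "reverse_norm M U u = L2_norm M (ae_Sup M ((\<lambda>x. mag (U (u x))) ` {0..}))"

definition reverse_space ::
  "'l measure \<Rightarrow> ('h \<Rightarrow> 'l \<Rightarrow> real) \<Rightarrow> (real \<Rightarrow> 'h) set" where
  "reverse_space M U = {u. reverse_norm M U u < \<infinity>}"

definition pointwise_ext ::
  "('h \<Rightarrow> 'h \<Rightarrow> 'h) \<Rightarrow> (real \<Rightarrow> 'h) \<Rightarrow> (real \<Rightarrow> 'h) \<Rightarrow> real \<Rightarrow> 'h" where
  "pointwise_ext D u v = (\<lambda>x. D (u x) (v x))"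

definition closed_under_pointwise_ext ::
  "'l measure \<Rightarrow> ('h \<Rightarrow> 'l \<Rightarrow> real) \<Rightarrow> ('h \<Rightarrow> 'h \<Rightarrow> 'h) \<Rightarrow> bool" where
  "closed_under_pointwise_ext M U D \<longleftrightarrow>
     (\<forall>v\<in>reverse_space M U. pointwise_ext D v v \<in> reverse_space M U) \<and>
     (\<exists>C::real. C \<ge> 0 \<and> (\<forall>v\<in>reverse_space M U.
        reverse_norm M U (pointwise_ext D v v) \<le> ennreal C * (reverse_norm M U v)\<^sup>2))"


section \<open>The sets \<open>\<E>\<^sub>\<alpha>\<close> and the function \<open>\<S>(\<alpha>)\<close>\<close>

definition dominated_vectors ::
  "'l measure \<Rightarrow> ('h \<Rightarrow> 'l \<Rightarrow> real) \<Rightarrow> ('l \<Rightarrow> real) \<Rightarrow> 'h set" where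
  "dominated_vectors M U \<alpha> = {v. AE l in M. \<bar>U v l\<bar> \<le> \<bar>\<alpha> l\<bar>}"

definition sup_action ::
  "'l measure \<Rightarrow> ('h \<Rightarrow> 'l \<Rightarrow> real) \<Rightarrow> ('h \<Rightarrow> 'h \<Rightarrow> 'h) \<Rightarrow> ('l \<Rightarrow> real) \<Rightarrow> 'l \<Rightarrow> ennreal" where
  "sup_action M U D \<alpha> = ae_Sup M ((\<lambda>v. mag (U (D v v))) ` dominated_vectors M U \<alpha>)"

end

theory Submission
  imports Defs
begin

text \<open>
  The quadratic map \<open>v \<mapsto> D(v,v)\<close> acts on each value of a function separately, so a function \<open>v\<close>
  in the reverse-norm space matters only through the family of its values. With \<open>\<alpha>\<close> the supremum
  of \<open>\<bar>v\<^sub>\<lambda>(x)\<bar>\<close> over \<open>x\<close>, all values lie in \<open>\<E>\<^sub>\<alpha>\<close>, so \<open>\<S>(\<alpha>)\<close> dominates the coordinates of all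
  \<open>D(v(x),v(x))\<close>; a bound on \<open>\<S>\<close> is therefore a bound on the pointwise action.

  Conversely, one would like a function that runs through all of \<open>\<E>\<^sub>\<alpha>\<close>. This set may have more
  elements than \<open>[0,\<infinity>)\<close>, but a step function can run through any prescribed sequence in it. This
  suffices, because an essential supremum is already attained on a countable subfamily:
  if the pointwise suprema of the countable subfamilies are bounded in \<open>L\<^sup>2\<close>, then one that
  maximises the \<open>L\<^sup>2\<close> norm cannot be enlarged by any further member on a set of positive measure
  (\<open>is_ae_Sup_countable_subfamily\<close>). The same fact bounds the supremum over the values
  of \<open>D(v(x),v(x))\<close> in the first direction: it exists because \<open>\<S>(\<alpha>)\<close> is a dominating function
  in \<open>L\<^sup>2\<close>.
\<close>

section \<open>The \<open>L\<^sup>2\<close> norm of functions with values in \<open>[0,\<infinity>]\<close>\<close>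

lemma esqrt_mono: "x \<le> y \<Longrightarrow> esqrt x \<le> esqrt y"
  by (auto simp: esqrt_def top_unique less_top intro!: ennreal_leI enn2real_mono)

lemma esqrt_power2: "esqrt (x\<^sup>2) = x"
  by (cases x) (auto simp: esqrt_def ennreal_power)

lemma power2_esqrt: "(esqrt x)\<^sup>2 = x"
  by (cases x) (auto simp: esqrt_def ennreal_power)

lemma L2_norm_power2: "(L2_norm M f)\<^sup>2 = (\<integral>\<^sup>+ l. (f l)\<^sup>2 \<partial>M)"
  by (simp add: L2_norm_def power2_esqrt)

lemma L2_norm_mono_AE:
  assumes "AE l in M. f l \<le> g l"
  shows "L2_norm M f \<le> L2_norm M g"
  unfolding L2_norm_def using assms
  by (intro esqrt_mono nn_integral_mono_AE) (auto elim!: eventually_mono intro: power_mono)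

lemma L2_norm_cong_AE:
  assumes "AE l in M. f l = g l"
  shows "L2_norm M f = L2_norm M g"
  using assms by (intro antisym L2_norm_mono_AE) (auto elim!: eventually_mono)

lemma AE_finite_if_L2_norm_finite:
  assumes "f \<in> borel_measurable M" and "L2_norm M f < \<infinity>"
  shows "AE l in M. f l < \<infinity>"
proof -
  have "(\<integral>\<^sup>+ l. (f l)\<^sup>2 \<partial>M) \<noteq> \<infinity>"
    using assms(2) by (auto simp: L2_norm_def esqrt_def)
  then have "AE l in M. (f l)\<^sup>2 \<noteq> \<infinity>"
    using assms(1) by (intro nn_integral_noteq_infinite) auto
  then show ?thesis
    by eventually_elim (auto simp: less_top[symmetric] power2_eq_square ennreal_mult_eq_top_iff)
qed

lemma AE_le_if_L2_norm_le:
  assumes "f \<in> borel_measurable M" "g \<in> borel_measurable M"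
    and "AE l in M. f l \<le> g l" and "L2_norm M g \<le> L2_norm M f" and "L2_norm M f < \<infinity>"
  shows "AE l in M. g l \<le> f l"
proof -
  have le: "(\<integral>\<^sup>+ l. (g l)\<^sup>2 \<partial>M) \<le> (\<integral>\<^sup>+ l. (f l)\<^sup>2 \<partial>M)"
    using assms(4) by (simp flip: L2_norm_power2 add: power_mono)
  have fin: "(\<integral>\<^sup>+ l. (f l)\<^sup>2 \<partial>M) \<noteq> \<infinity>"
    using assms(5) by (auto simp: L2_norm_def esqrt_def)
  have "AE l in M. (f l)\<^sup>2 \<le> (g l)\<^sup>2"
    using assms(3) by eventually_elim (rule power_mono, auto)
  moreover have "(\<lambda>l. (f l)\<^sup>2) \<in> borel_measurable M" "(\<lambda>l. (g l)\<^sup>2) \<in> borel_measurable M"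
    using assms(1,2) by measurable
  ultimately have "AE l in M. (g l)\<^sup>2 \<le> (f l)\<^sup>2"
    using nn_integral_less[of "\<lambda>l. (f l)\<^sup>2" M "\<lambda>l. (g l)\<^sup>2"] le fin
    by (meson not_le)
  then show ?thesis
    by eventually_elim (metis esqrt_mono esqrt_power2)
qed


section \<open>Existence and norm of essential suprema\<close>

lemma SUP_measurable_countable:
  assumes "countable K" and "K \<subseteq> borel_measurable M"
  shows "(\<lambda>l. SUP f\<in>K. f l :: ennreal) \<in> borel_measurable M"
  using is_ae_Sup_countable[OF assms] by (simp add: is_ae_Sup_def)

text \<open>An exhaustion argument: the supremum of the norms over all countable subfamilies is attained,
  because the union of a maximising sequence of countable subfamilies is again countable. Adding
  any other member of the family cannot increase the norm of a maximiser, which is finite, hence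
  changes its supremum only on a null set.\<close>

lemma is_ae_Sup_countable_subfamily:
  assumes F: "F \<subseteq> borel_measurable M"
    and bound: "\<And>K. \<lbrakk>countable K; K \<subseteq> F\<rbrakk> \<Longrightarrow> L2_norm M (\<lambda>l. SUP f\<in>K. f l) \<le> B"
    and B: "B < \<infinity>"
  obtains K where "countable K" "K \<subseteq> F" "is_ae_Sup M F (\<lambda>l. SUP f\<in>K. f l)"
proof -
  define \<K> where "\<K> = {K. countable K \<and> K \<subseteq> F}"
  define N where "N K = L2_norm M (\<lambda>l. SUP f\<in>K. f l)" for K
  have "{} \<in> \<K>" by (simp add: \<K>_def)
  then have "N ` \<K> \<noteq> {}" by blast
  then obtain s :: "nat \<Rightarrow> ennreal"
    where s: "range s \<subseteq> N ` \<K>" "Sup (N ` \<K>) = (SUP n. s n)"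
    using ennreal_Sup_countable_SUP by metis
  then have "\<forall>n. \<exists>K\<in>\<K>. s n = N K" by blast
  then obtain k where k: "k n \<in> \<K>" "s n = N (k n)" for n by metis
  define K where "K = (\<Union>n. k n)"
  have K: "countable K" "K \<subseteq> F" using k(1) by (auto simp: K_def \<K>_def)
  have "s n \<le> N K" for n
    unfolding k(2) N_def K_def
    by (intro L2_norm_mono_AE AE_I2 SUP_subset_mono) auto
  then have max: "N K' \<le> N K" if "K' \<in> \<K>" for K'
    using s(2) that by (metis SUP_least SUP_upper order_trans)
  have "AE l in M. f l \<le> (SUP f\<in>K. f l)" if f: "f \<in> F" for f
  proof -
    have ins: "insert f K \<in> \<K>" using K f by (simp add: \<K>_def)
    have "AE l in M. (SUP f\<in>insert f K. f l) \<le> (SUP f\<in>K. f l)"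
    proof (rule AE_le_if_L2_norm_le)
      show "(\<lambda>l. SUP f\<in>K. f l) \<in> borel_measurable M"
        using K F by (intro SUP_measurable_countable) auto
      show "(\<lambda>l. SUP f\<in>insert f K. f l) \<in> borel_measurable M"
        using K F f by (intro SUP_measurable_countable) auto
      show "AE l in M. (SUP f\<in>K. f l) \<le> (SUP f\<in>insert f K. f l)"
        by (intro AE_I2 SUP_subset_mono) auto
      show "L2_norm M (\<lambda>l. SUP f\<in>insert f K. f l) \<le> L2_norm M (\<lambda>l. SUP f\<in>K. f l)"
        using max[OF ins] by (simp only: N_def)
      show "L2_norm M (\<lambda>l. SUP f\<in>K. f l) < \<infinity>"
        using bound[OF K] B by (rule le_less_trans)
    qed
    then show ?thesis by eventually_elim simp
  qed
  moreover have "is_ae_Sup M K (\<lambda>l. SUP f\<in>K. f l)"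
    using K F by (intro is_ae_Sup_countable) auto
  ultimately have "is_ae_Sup M F (\<lambda>l. SUP f\<in>K. f l)"
    using K(2) unfolding is_ae_Sup_def by blast
  with K that show thesis by blast
qed

lemma is_ae_Sup_ae_Sup: "is_ae_Sup M F g \<Longrightarrow> is_ae_Sup M F (ae_Sup M F)"
  by (auto simp: ae_Sup_def intro: someI[of "is_ae_Sup M F"])

lemma ae_Sup_measurable: "ae_Sup M F \<in> borel_measurable M"
proof (cases "\<exists>g. is_ae_Sup M F g")
  case True
  then show ?thesis using is_ae_Sup_ae_Sup by (auto simp: is_ae_Sup_def)
next
  case False
  then show ?thesis by (simp add: ae_Sup_def)
qed

text \<open>When a family has no essential supremum, \<open>ae_Sup\<close> is the constant \<open>\<infinity>\<close>, which is still an upper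
  bound.\<close>

lemma ae_Sup_upper: "f \<in> F \<Longrightarrow> AE l in M. f l \<le> ae_Sup M F l"
proof (cases "\<exists>g. is_ae_Sup M F g")
  case True
  assume "f \<in> F"
  with True show ?thesis using is_ae_Sup_ae_Sup unfolding is_ae_Sup_def by blast
next
  case False
  then show ?thesis by (simp add: ae_Sup_def)
qed

lemma L2_norm_ae_Sup_eq:
  assumes "is_ae_Sup M F g"
  shows "L2_norm M (ae_Sup M F) = L2_norm M g"
  using is_ae_Sup_ae_Sup[OF assms] assms by (intro L2_norm_cong_AE is_ae_Sup_unique)

lemma L2_norm_ae_Sup_countable:
  assumes "countable F" and "F \<subseteq> borel_measurable M"
  shows "L2_norm M (ae_Sup M F) = L2_norm M (\<lambda>l. SUP f\<in>F. f l)"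
  using is_ae_Sup_countable[OF assms] by (rule L2_norm_ae_Sup_eq)

text \<open>Norm bounds for arbitrary families are thereby reduced to countable ones.\<close>

lemma L2_norm_ae_Sup_le:
  assumes "F \<subseteq> borel_measurable M"
    and "\<And>K. \<lbrakk>countable K; K \<subseteq> F\<rbrakk> \<Longrightarrow> L2_norm M (\<lambda>l. SUP f\<in>K. f l) \<le> B"
    and "B < \<infinity>"
  shows "L2_norm M (ae_Sup M F) \<le> B"
  using is_ae_Sup_countable_subfamily[OF assms] assms(2) L2_norm_ae_Sup_eq by metis

lemma L2_norm_ae_Sup_le_dominating:
  assumes F: "F \<subseteq> borel_measurable M"
    and dom: "\<And>f. f \<in> F \<Longrightarrow> AE l in M. f l \<le> h l"
    and h: "L2_norm M h < \<infinity>"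
  shows "L2_norm M (ae_Sup M F) \<le> L2_norm M h"
proof (rule L2_norm_ae_Sup_le[OF F _ h])
  fix K assume "countable K" "K \<subseteq> F"
  then have "AE l in M. \<forall>f\<in>K. f l \<le> h l"
    using dom by (subst AE_ball_countable) auto
  then show "L2_norm M (\<lambda>l. SUP f\<in>K. f l) \<le> L2_norm M h"
    by (intro L2_norm_mono_AE) (auto elim!: eventually_mono intro: SUP_least)
qed


section \<open>Pointwise action and the function \<open>\<S>(\<alpha>)\<close>\<close>

lemma mag_measurable: "f \<in> L2 M \<Longrightarrow> mag f \<in> borel_measurable M"
  by (auto simp: L2_def)

text \<open>The envelope \<open>\<alpha>\<close> of a function in the reverse-norm space: it is the essential supremum of the
  coordinates, made real-valued, which alters it only on the null set where it is infinite.\<close>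

lemma reverse_space_envelope:
  assumes "v \<in> reverse_space M U"
  obtains \<alpha> where "\<alpha> \<in> L2 M" "L2_norm M (mag \<alpha>) = reverse_norm M U v"
    "\<And>x. x \<ge> 0 \<Longrightarrow> v x \<in> dominated_vectors M U \<alpha>"
proof -
  define A where "A = ae_Sup M ((\<lambda>x. mag (U (v x))) ` {0..})"
  define \<alpha> where "\<alpha> l = enn2real (A l)" for l
  have A: "A \<in> borel_measurable M" by (simp add: A_def ae_Sup_measurable)
  have fin: "L2_norm M A < \<infinity>"
    using assms by (simp add: reverse_space_def reverse_norm_def A_def)
  have eq: "AE l in M. mag \<alpha> l = A l"
    using AE_finite_if_L2_norm_finite[OF A fin] by eventually_elim (simp add: \<alpha>_def)
  have norm: "L2_norm M (mag \<alpha>) = L2_norm M A"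
    by (rule L2_norm_cong_AE[OF eq])
  have "\<alpha> \<in> L2 M"
    using A fin norm by (simp add: L2_def \<alpha>_def[abs_def])
  moreover have "L2_norm M (mag \<alpha>) = reverse_norm M U v"
    by (simp add: norm reverse_norm_def A_def)
  moreover have "v x \<in> dominated_vectors M U \<alpha>" if "x \<ge> 0" for x
  proof -
    have "AE l in M. mag (U (v x)) l \<le> A l"
      unfolding A_def using that by (intro ae_Sup_upper) auto
    with eq show ?thesis
      unfolding dominated_vectors_def mem_Collect_eq
      by eventually_elim (metis abs_ge_zero ennreal_le_iff)
  qed
  ultimately show thesis by (rule that)
qed

lemma reverse_norm_pointwise_ext_le:
  assumes U: "\<And>u. U u \<in> L2 M"
    and v: "\<And>x. x \<ge> 0 \<Longrightarrow> v x \<in> dominated_vectors M U \<alpha>"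
    and S: "sup_action M U D \<alpha> \<in> L2_ext M"
  shows "reverse_norm M U (pointwise_ext D v v) \<le> L2_norm M (sup_action M U D \<alpha>)"
  unfolding reverse_norm_def
proof (rule L2_norm_ae_Sup_le_dominating)
  show "(\<lambda>x. mag (U (pointwise_ext D v v x))) ` {0..} \<subseteq> borel_measurable M"
    using mag_measurable[OF U] by blast
  show "L2_norm M (sup_action M U D \<alpha>) < \<infinity>"
    using S by (simp add: L2_ext_def)
next
  fix f assume "f \<in> (\<lambda>x. mag (U (pointwise_ext D v v x))) ` {0..}"
  then show "AE l in M. f l \<le> sup_action M U D \<alpha> l"
    unfolding sup_action_def using v by (intro ae_Sup_upper) (auto simp: pointwise_ext_def)
qed

text \<open>A step function on \<open>[0,\<infinity>)\<close> that enumerates a countable set of vectors in \<open>\<E>\<^sub>\<alpha>\<close> transfers the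
  bound on the pointwise action to that set.\<close>

lemma L2_norm_countable_action_le:
  assumes U: "\<And>u. U u \<in> L2 M"
    and closed: "\<And>v. v \<in> reverse_space M U \<Longrightarrow>
      reverse_norm M U (pointwise_ext D v v) \<le> ennreal C * (reverse_norm M U v)\<^sup>2"
    and \<alpha>: "\<alpha> \<in> L2 M"
    and V: "countable V" "V \<subseteq> dominated_vectors M U \<alpha>"
  shows "L2_norm M (\<lambda>l. SUP v\<in>V. mag (U (D v v)) l) \<le> ennreal C * (L2_norm M (mag \<alpha>))\<^sup>2"
proof (cases "V = {}")
  case True
  then show ?thesis by (simp add: L2_norm_def esqrt_def bot_ennreal)
next
  case False
  define u where "u x = from_nat_into V (nat \<lfloor>x\<rfloor>)" for x :: real
  have "V \<subseteq> u ` {0..}"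
  proof
    fix v assume "v \<in> V"
    then obtain n where "v = from_nat_into V n"
      using from_nat_into_surj[OF V(1)] by metis
    then have "v = u (real n)" by (simp add: u_def)
    then show "v \<in> u ` {0..}" by auto
  qed
  then have range: "u ` {0..} = V"
    using from_nat_into[OF False] by (auto simp: u_def)
  have "reverse_norm M U u \<le> L2_norm M (mag \<alpha>)"
    unfolding reverse_norm_def
  proof (rule L2_norm_ae_Sup_le_dominating)
    show "(\<lambda>x. mag (U (u x))) ` {0..} \<subseteq> borel_measurable M"
      using mag_measurable[OF U] by blast
    show "L2_norm M (mag \<alpha>) < \<infinity>" using \<alpha> by (simp add: L2_def)
  next
    fix f assume "f \<in> (\<lambda>x. mag (U (u x))) ` {0..}"
    then obtain v where "v \<in> V" and f: "f = mag (U v)" using range by blast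
    then have "AE l in M. \<bar>U v l\<bar> \<le> \<bar>\<alpha> l\<bar>" using V(2) by (auto simp: dominated_vectors_def)
    then show "AE l in M. f l \<le> mag \<alpha> l" unfolding f by eventually_elim (rule ennreal_leI)
  qed
  moreover from this have "u \<in> reverse_space M U"
    using \<alpha> by (auto simp: reverse_space_def L2_def intro: le_less_trans)
  ultimately have "reverse_norm M U (pointwise_ext D u u) \<le> ennreal C * (L2_norm M (mag \<alpha>))\<^sup>2"
    using closed by (meson mult_left_mono order_trans power_mono zero_le)
  moreover have "(\<lambda>x. mag (U (pointwise_ext D u u x))) ` {0..} = (\<lambda>v. mag (U (D v v))) ` V"
    unfolding range[symmetric] image_image pointwise_ext_def ..
  moreover have "L2_norm M (ae_Sup M ((\<lambda>v. mag (U (D v v))) ` V))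
      = L2_norm M (\<lambda>l. SUP v\<in>V. mag (U (D v v)) l)"
    using V(1) mag_measurable[OF U]
    by (subst L2_norm_ae_Sup_countable) (auto simp: image_image)
  ultimately show ?thesis by (simp add: reverse_norm_def)
qed

lemma L2_norm_sup_action_le:
  assumes U: "\<And>u. U u \<in> L2 M"
    and closed: "\<And>v. v \<in> reverse_space M U \<Longrightarrow>
      reverse_norm M U (pointwise_ext D v v) \<le> ennreal C * (reverse_norm M U v)\<^sup>2"
    and \<alpha>: "\<alpha> \<in> L2 M"
  shows "L2_norm M (sup_action M U D \<alpha>) \<le> ennreal C * (L2_norm M (mag \<alpha>))\<^sup>2"
  unfolding sup_action_def
proof (rule L2_norm_ae_Sup_le)
  show "(\<lambda>v. mag (U (D v v))) ` dominated_vectors M U \<alpha> \<subseteq> borel_measurable M"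
    using mag_measurable[OF U] by blast
  show "ennreal C * (L2_norm M (mag \<alpha>))\<^sup>2 < \<infinity>"
    using \<alpha> by (simp add: L2_def ennreal_mult_less_top power_less_top_ennreal)
next
  fix K assume "countable K" "K \<subseteq> (\<lambda>v. mag (U (D v v))) ` dominated_vectors M U \<alpha>"
  then obtain V where V: "countable V" "V \<subseteq> dominated_vectors M U \<alpha>"
    and K: "K = (\<lambda>v. mag (U (D v v))) ` V"
    using countable_subset_image[THEN iffD1, OF conjI] by meson
  show "L2_norm M (\<lambda>l. SUP f\<in>K. f l) \<le> ennreal C * (L2_norm M (mag \<alpha>))\<^sup>2"
    using L2_norm_countable_action_le[OF U closed \<alpha> V] by (simp add: K image_image)
qed

theorem proposition1p1:
  fixes \<Gamma> :: "'h::{real_inner, complete_space} \<Rightarrow> 'h"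
    and D :: "'h \<Rightarrow> 'h \<Rightarrow> 'h"
    and M :: "'l measure"
    and \<gamma> :: "'l \<Rightarrow> real"
    and U :: "'h \<Rightarrow> 'l \<Rightarrow> real"
  assumes "bounded_linear \<Gamma>"
    and "\<And>u v. inner (\<Gamma> u) v = inner u (\<Gamma> v)"
    and "inj \<Gamma>"
    and "\<not> boundedly_invertible \<Gamma>"
    and "bounded_bilinear D"
    and "spectral_coordinates \<Gamma> M \<gamma> U"
  shows "closed_under_pointwise_ext M U D \<longleftrightarrow>
    (\<exists>C::real. C > 0 \<and> (\<forall>\<alpha>\<in>L2 M.
       sup_action M U D \<alpha> \<in> L2_ext M \<and>
       L2_norm M (sup_action M U D \<alpha>) \<le> ennreal C * (L2_norm M (mag \<alpha>))\<^sup>2))"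
proof
  have U: "U u \<in> L2 M" for u
    using assms(6) by (simp add: spectral_coordinates_def)
  {
    assume "closed_under_pointwise_ext M U D"
    then obtain C where C: "C \<ge> 0" and closed: "\<And>v. v \<in> reverse_space M U \<Longrightarrow>
        reverse_norm M U (pointwise_ext D v v) \<le> ennreal C * (reverse_norm M U v)\<^sup>2"
      unfolding closed_under_pointwise_ext_def by blast
    have le: "L2_norm M (sup_action M U D \<alpha>) \<le> ennreal (C + 1) * (L2_norm M (mag \<alpha>))\<^sup>2"
      if "\<alpha> \<in> L2 M" for \<alpha>
    proof -
      have "L2_norm M (sup_action M U D \<alpha>) \<le> ennreal C * (L2_norm M (mag \<alpha>))\<^sup>2"
        using U closed that by (rule L2_norm_sup_action_le)
      also have "\<dots> \<le> ennreal (C + 1) * (L2_norm M (mag \<alpha>))\<^sup>2"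
        by (intro mult_right_mono ennreal_leI) auto
      finally show ?thesis .
    qed
    have "sup_action M U D \<alpha> \<in> L2_ext M" if \<alpha>: "\<alpha> \<in> L2 M" for \<alpha>
    proof -
      have "ennreal (C + 1) * (L2_norm M (mag \<alpha>))\<^sup>2 < \<infinity>"
        using \<alpha> by (simp add: L2_def ennreal_mult_less_top power_less_top_ennreal)
      then show ?thesis
        using le[OF \<alpha>] by (auto simp: L2_ext_def sup_action_def ae_Sup_measurable)
    qed
    with le C show "\<exists>C::real. C > 0 \<and> (\<forall>\<alpha>\<in>L2 M. sup_action M U D \<alpha> \<in> L2_ext M \<and>
        L2_norm M (sup_action M U D \<alpha>) \<le> ennreal C * (L2_norm M (mag \<alpha>))\<^sup>2)"
      \<comment> \<open>The constant of closedness may be \<open>0\<close>, whereas a positive one is sought.\<close>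
      by (intro exI[of _ "C + 1"]) auto
  next
    assume "\<exists>C::real. C > 0 \<and> (\<forall>\<alpha>\<in>L2 M. sup_action M U D \<alpha> \<in> L2_ext M \<and>
        L2_norm M (sup_action M U D \<alpha>) \<le> ennreal C * (L2_norm M (mag \<alpha>))\<^sup>2)"
    then obtain C where C: "C > 0" and S: "\<And>\<alpha>. \<alpha> \<in> L2 M \<Longrightarrow> sup_action M U D \<alpha> \<in> L2_ext M"
      "\<And>\<alpha>. \<alpha> \<in> L2 M \<Longrightarrow>
        L2_norm M (sup_action M U D \<alpha>) \<le> ennreal C * (L2_norm M (mag \<alpha>))\<^sup>2"
      by blast
    have le: "reverse_norm M U (pointwise_ext D v v) \<le> ennreal C * (reverse_norm M U v)\<^sup>2"
      if v: "v \<in> reverse_space M U" for v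
    proof -
      obtain \<alpha> where \<alpha>: "\<alpha> \<in> L2 M" "L2_norm M (mag \<alpha>) = reverse_norm M U v"
        "\<And>x. x \<ge> 0 \<Longrightarrow> v x \<in> dominated_vectors M U \<alpha>"
        using reverse_space_envelope[OF v] by blast
      have "reverse_norm M U (pointwise_ext D v v) \<le> L2_norm M (sup_action M U D \<alpha>)"
        using U \<alpha>(3) S(1)[OF \<alpha>(1)] by (rule reverse_norm_pointwise_ext_le)
      also have "\<dots> \<le> ennreal C * (reverse_norm M U v)\<^sup>2"
        using S(2)[OF \<alpha>(1)] by (simp add: \<alpha>(2))
      finally show ?thesis .
    qed
    have "pointwise_ext D v v \<in> reverse_space M U" if v: "v \<in> reverse_space M U" for v
    proof -
      have "ennreal C * (reverse_norm M U v)\<^sup>2 < \<infinity>"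
        using v by (simp add: reverse_space_def ennreal_mult_less_top power_less_top_ennreal)
      then show ?thesis
        using le[OF v] by (auto simp: reverse_space_def)
    qed
    with le C show "closed_under_pointwise_ext M U D"
      unfolding closed_under_pointwise_ext_def by (intro conjI ballI exI[of _ C]) auto
  }
qed

end
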